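(* Let $G$ be a connected graph of order $n$. Then $A(G)\geq (n+2)/3$, with equality if and only if $G$ is a path.
   Context: All graphs are finite and simple. A connected set of a graph $G$ is a nonempty set of vertices of $G$ that induces a connected subgraph of $G$ (the empty set is not a connected set). $A(G)$ denotes the average cardinality of a connected set of $G$, the average being taken over all connected sets of $G$. *)

theory Defs
  imports Complex_Main "Graph_Theory.Digraph_Component" "Graph_Theory.Vertex_Walk"
begin

(* Digraph_Component.connected is qualified because Complex_Main has a topological connected. *)
definition connected_sets :: "('a, 'b) pre_digraph \<Rightarrow> 'a set set" where
  "connected_sets G =
     {S. S \<subseteq> verts G \<and> S \<noteq> {} \<and> Digraph_Component.connected (G \<restriction> S)}"

definition avg_connected :: "('a, 'b) pre_digraph \<Rightarrow> real" where
  "avg_connected G =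
     (\<Sum>S\<in>connected_sets G. real (card S)) / real (card (connected_sets G))"

(* G consists of exactly the vertices of a vertex-simple walk vs and the edges between
   successive vertices of vs, each present as a pair of opposite arcs.
   The one-vertex graph counts as a path. *)
definition is_path_graph :: "('a, 'b) pre_digraph \<Rightarrow> bool" where
  "is_path_graph G \<longleftrightarrow>
     (\<exists>vs. vpath vs G \<and> set vs = verts G \<and>
           arcs_ends G = set (vwalk_arcs vs) \<union> (set (vwalk_arcs vs))\<inverse>)"

end

theory Submission
  imports Defs
begin

text \<open>
  Count the pairs (T, w) of a connected set T and a vertex w outside T; there are
  (n - |T|) summed over all T of them. Assign to each pair a minimal connected set H containing
  T and w. A fixed H is hit by at most 2(|H| - 1) pairs: for fixed w the sets T form a chain, and
  for distinct w, w' the complements H - T, H - T' are disjoint unless w and w' are the only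
  vertices that occur. So the sum of n - |T| is at most the sum of 2(|H| - 1), which rearranges to
  the bound. Equality for H = V forces a pair ({u}, w) that no proper connected subset of V joins,
  so G is a path from u to w.
\<close>

subsection \<open>Connectivity by cuts\<close>

text \<open>Says that no nonempty proper part of \<open>S\<close> is closed under \<open>E\<close>
  inside \<open>S\<close>, which is strong connectivity of the induced digraph and plain
  connectivity for symmetric \<open>E\<close>. The cut form makes unions and one-vertex extensions
  easy, without walks.\<close>

definition cut_connected :: "('a \<times> 'a) set \<Rightarrow> 'a set \<Rightarrow> bool" where
  "cut_connected E S \<longleftrightarrow>
     S \<noteq> {} \<and> (\<forall>A. A \<noteq> {} \<and> A \<subset> S \<longrightarrow> (\<exists>a\<in>A. \<exists>b\<in>S - A. (a, b) \<in> E))"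

lemma cut_connectedE:
  assumes "cut_connected E S" "A \<noteq> {}" "A \<subset> S"
  obtains a b where "a \<in> A" "b \<in> S" "b \<notin> A" "(a, b) \<in> E"
  using assms unfolding cut_connected_def by blast

lemma cut_connected_nonempty: "cut_connected E S \<Longrightarrow> S \<noteq> {}"
  by (simp add: cut_connected_def)

lemma cut_connected_singleton: "cut_connected E {v}"
  by (auto simp: cut_connected_def)

lemma cut_connected_pair:
  assumes "sym E" "(a, b) \<in> E"
  shows "cut_connected E {a, b}"
  unfolding cut_connected_def
proof (intro conjI allI impI)
  fix A assume A: "A \<noteq> {} \<and> A \<subset> {a, b}"
  then have "A = {a} \<and> a \<noteq> b \<or> A = {b} \<and> a \<noteq> b" by blast
  then show "\<exists>x\<in>A. \<exists>y\<in>{a, b} - A. (x, y) \<in> E"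
    using assms by (auto dest: symD)
qed simp

lemma cut_connected_Un:
  assumes "cut_connected E A" "cut_connected E B" "A \<inter> B \<noteq> {}"
  shows "cut_connected E (A \<union> B)"
  unfolding cut_connected_def
proof (intro conjI allI impI)
  show "A \<union> B \<noteq> {}" using assms(3) by blast
  fix X assume X: "X \<noteq> {} \<and> X \<subset> A \<union> B"
  \<comment> \<open>If \<open>X\<close> met each of \<open>A\<close> and \<open>B\<close> in nothing
    or in everything, a common point of \<open>A\<close> and \<open>B\<close> would make
    \<open>X\<close> empty or the whole union.\<close>
  consider "X \<inter> A \<noteq> {}" "X \<inter> A \<subset> A" | "X \<inter> B \<noteq> {}" "X \<inter> B \<subset> B"
    using X assms(3) by blast
  then show "\<exists>a\<in>X. \<exists>b\<in>A \<union> B - X. (a, b) \<in> E"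
  proof cases
    case 1
    then show ?thesis by (rule cut_connectedE[OF assms(1)]) blast
  next
    case 2
    then show ?thesis by (rule cut_connectedE[OF assms(2)]) blast
  qed
qed

lemma cut_connected_insert:
  assumes "sym E" "cut_connected E S" "a \<in> S" "(a, x) \<in> E"
  shows "cut_connected E (insert x S)"
proof -
  have "cut_connected E (S \<union> {a, x})"
    using assms by (intro cut_connected_Un cut_connected_pair) auto
  moreover have "S \<union> {a, x} = insert x S" using assms(3) by blast
  ultimately show ?thesis by simp
qed

subsection \<open>Minimal connected sets joining a connected set and a vertex\<close>

text \<open>Minimality is with respect to inclusion, not size. For symmetric \<open>E\<close> the
  picture is that \<open>H\<close> consists of \<open>T\<close> and a chordless path that leads from
  \<open>T\<close> to \<open>w\<close> and touches \<open>T\<close> only at its start.\<close>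

definition irreducible_join :: "('a \<times> 'a) set \<Rightarrow> 'a set \<Rightarrow> 'a set \<Rightarrow> 'a \<Rightarrow> bool" where
  "irreducible_join E H T w \<longleftrightarrow>
     cut_connected E H \<and> cut_connected E T \<and> T \<subseteq> H \<and> w \<in> H - T \<and>
     (\<forall>X. cut_connected E X \<longrightarrow> X \<subseteq> H \<longrightarrow> T \<subseteq> X \<longrightarrow> w \<in> X \<longrightarrow> X = H)"

lemma irreducible_joinD:
  assumes "irreducible_join E H T w"
  shows "cut_connected E H" "cut_connected E T" "T \<subseteq> H" "w \<in> H" "w \<notin> T"
    "\<And>X. cut_connected E X \<Longrightarrow> X \<subseteq> H \<Longrightarrow> T \<subseteq> X \<Longrightarrow> w \<in> X \<Longrightarrow> X = H"
  using assms unfolding irreducible_join_def by blast+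

lemma irreducible_join_exists:
  assumes "finite V" "cut_connected E V" "cut_connected E T" "T \<subseteq> V" "w \<in> V - T"
  obtains H where "H \<subseteq> V" "irreducible_join E H T w"
proof -
  let ?P = "\<lambda>X. cut_connected E X \<and> X \<subseteq> V \<and> T \<subseteq> X \<and> w \<in> X"
  have "finite {X. ?P X}" using assms(1) by (auto intro: finite_subset[of _ "Pow V"])
  moreover have "V \<in> {X. ?P X}" using assms by auto
  ultimately obtain H where H: "?P H" and min: "\<And>X. ?P X \<Longrightarrow> X \<subseteq> H \<Longrightarrow> X = H"
    using finite_has_minimal2[of "{X. ?P X}" V] by (smt (verit, ccfv_threshold) mem_Collect_eq)
  have "irreducible_join E H T w"
    unfolding irreducible_join_def using assms(3,5) H min order.trans[of _ H V] by auto
  with H that show ?thesis by blast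
qed

text \<open>Take a maximal connected \<open>M\<close> between \<open>T\<close> and
  \<open>H - {w}\<close>. An edge leaving \<open>M\<close> inside \<open>H\<close> can only go to
  \<open>w\<close>, since any other endpoint would enlarge \<open>M\<close>. So
  \<open>insert w M\<close> is connected, and minimality of \<open>H\<close> makes it all of
  \<open>H\<close>.\<close>

lemma irreducible_join_Diff_connected:
  assumes "finite H" "sym E" and T: "irreducible_join E H T w"
  shows "cut_connected E (H - {w})"
proof -
  let ?P = "\<lambda>X. cut_connected E X \<and> X \<subseteq> H - {w} \<and> T \<subseteq> X"
  note D = irreducible_joinD[OF T]
  have "finite {X. ?P X}" using assms(1) by (auto intro: finite_subset[of _ "Pow H"])
  moreover have "T \<in> {X. ?P X}" using D by auto
  ultimately obtain M where M: "?P M" and max: "\<And>X. ?P X \<Longrightarrow> M \<subseteq> X \<Longrightarrow> X = M"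
    using finite_has_maximal2[of "{X. ?P X}" T] by (smt (verit, ccfv_threshold) mem_Collect_eq)
  obtain a b where ab: "a \<in> M" "b \<in> H" "b \<notin> M" "(a, b) \<in> E"
    using cut_connectedE[OF D(1), of M] M D(4) cut_connected_nonempty by blast
  have ins: "cut_connected E (insert b M)"
    using cut_connected_insert[OF assms(2), of M a b] M ab by blast
  have "b = w"
    using max[of "insert b M"] ins M ab by blast
  then have "insert w M = H"
    using D(6)[of "insert b M"] ins M D(4) by blast
  then have "H - {w} = M" using M by blast
  with M show ?thesis by simp
qed

text \<open>A neighbour \<open>x\<close> of \<open>w\<close> takes over as end once \<open>w\<close>
  is deleted: a connected set joining \<open>T\<close> and \<open>x\<close> becomes one joining
  \<open>T\<close> and \<open>w\<close> when \<open>w\<close> is added, so it cannot be smaller. If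
  \<open>x\<close> lies in \<open>T\<close>, then \<open>T\<close> with \<open>w\<close> is already
  connected and the path has run out.\<close>

lemma irreducible_join_step:
  assumes "sym E" and T: "irreducible_join E H T w"
    and "cut_connected E (H - {w})" "x \<in> H - {w}" "(w, x) \<in> E"
  shows "T = H - {w} \<or> irreducible_join E (H - {w}) T x"
proof (cases "x \<in> T")
  case True
  note D = irreducible_joinD[OF T]
  have "cut_connected E (insert w T)"
    using cut_connected_insert[OF assms(1) D(2) True] assms(1,5) by (auto dest: symD)
  then have "insert w T = H" using D by blast
  then show ?thesis using D(5) by blast
next
  case False
  note D = irreducible_joinD[OF T]
  have "X = H - {w}" if X: "cut_connected E X" "X \<subseteq> H - {w}" "T \<subseteq> X" "x \<in> X" for X
  proof -
    have "cut_connected E (insert w X)"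
      using cut_connected_insert[OF assms(1) X(1) X(4)] assms(1,5) by (auto dest: symD)
    then have "insert w X = H" using D X by blast
    then show ?thesis using X by blast
  qed
  then show ?thesis
    unfolding irreducible_join_def using False assms D by blast
qed

text \<open>Delete \<open>w\<close> and let one and the same neighbour \<open>x\<close> replace it
  for both sets, by induction on the size of \<open>H\<close>. This ends when \<open>T'\<close> is
  all of \<open>H - {w}\<close>, which also contains \<open>T\<close>.\<close>

lemma irreducible_join_nested:
  assumes "finite H" "sym E" "irreducible_join E H T w" "irreducible_join E H T' w"
    and "card T \<le> card T'"
  shows "T \<subseteq> T'"
  using assms(1,3-5)
proof (induction "card H" arbitrary: H w rule: less_induct)
  case less
  note D = irreducible_joinD[OF less.prems(2)] and D' = irreducible_joinD[OF less.prems(3)]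
  show ?case
  proof (cases "T' = H - {w}")
    case True
    then show ?thesis using D by blast
  next
    case False
    have conn: "cut_connected E (H - {w})"
      using irreducible_join_Diff_connected[OF less.prems(1) assms(2) less.prems(2)] .
    have "T' \<subset> H - {w}" using False D' by blast
    then have "card T' < card (H - {w})"
      using less.prems(1) by (intro psubset_card_mono) auto
    \<comment> \<open>Here the sizes matter: \<open>T\<close> cannot fill \<open>H - {w}\<close>
      before the larger set \<open>T'\<close> does.\<close>
    then have TH: "T \<noteq> H - {w}" using less.prems(4) by auto
    obtain x where x: "x \<in> H - {w}" "(w, x) \<in> E"
    proof (rule cut_connectedE[OF D(1), of "{w}"])
      show "{w} \<subset> H" using D(3-5) cut_connected_nonempty[OF D(2)] by blast
    qed auto
    have "irreducible_join E (H - {w}) T x" "irreducible_join E (H - {w}) T' x"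
      using irreducible_join_step[OF assms(2) _ conn x] TH False less.prems by blast+
    moreover have "card (H - {w}) < card H"
      using less.prems(1) D(4) by (intro card_Diff1_less)
    ultimately show ?thesis using less by auto
  qed
qed

text \<open>\<open>H - {w'}\<close> is connected and contains \<open>w\<close>; if it contained
  \<open>T\<close> too, \<open>H\<close> would not be minimal for \<open>T\<close> and
  \<open>w\<close>.\<close>

lemma irreducible_join_other_end:
  assumes "finite H" "sym E" "irreducible_join E H T w" "irreducible_join E H T' w'" "w \<noteq> w'"
  shows "w' \<in> T"
proof (rule ccontr)
  assume "w' \<notin> T"
  moreover have "cut_connected E (H - {w'})"
    using irreducible_join_Diff_connected[OF assms(1,2,4)] .
  ultimately have "H - {w'} = H"
    using irreducible_joinD(3,4)[OF assms(3)] assms(5)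
    by (intro irreducible_joinD(6)[OF assms(3)]) auto
  then show False using irreducible_joinD(4)[OF assms(4)] by blast
qed

text \<open>If \<open>T\<close> and \<open>T'\<close> met, their union would be a connected subset
  of \<open>H\<close> containing \<open>T\<close> and, because \<open>w\<close> lies in
  \<open>T'\<close>, also \<open>w\<close>. Minimality would make it \<open>H\<close>.\<close>

lemma irreducible_join_disjoint:
  assumes "finite H" "sym E" "irreducible_join E H T w" "irreducible_join E H T' w'" "w \<noteq> w'"
    and "T \<union> T' \<noteq> H"
  shows "T \<inter> T' = {}"
proof (rule ccontr)
  note D = irreducible_joinD[OF assms(3)] and D' = irreducible_joinD[OF assms(4)]
  assume "T \<inter> T' \<noteq> {}"
  then have "cut_connected E (T \<union> T')" using cut_connected_Un D(2) D'(2) by blast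
  moreover have "w \<in> T'"
    using irreducible_join_other_end[OF assms(1,2,4,3)] assms(5) by simp
  ultimately show False using D D' assms(6) by blast
qed

text \<open>A third end would lie in both \<open>T\<close> and \<open>T'\<close>, which are
  disjoint.\<close>

lemma irreducible_join_two_ends:
  assumes "finite H" "sym E" "irreducible_join E H T w" "irreducible_join E H T' w'" "w \<noteq> w'"
    and "T \<union> T' \<noteq> H" "irreducible_join E H T'' w''"
  shows "w'' = w \<or> w'' = w'"
  using irreducible_join_disjoint[OF assms(1-6)]
    irreducible_join_other_end[OF assms(1,2,3,7)] irreducible_join_other_end[OF assms(1,2,4,7)]
  by blast

section \<open>Counting the pairs that share a minimal connected set\<close>

text \<open>The sets joined to \<open>w\<close> form a chain, so their sizes are distinct and lie
  between that of the smallest one, \<open>T\<close>, and \<open>card H - 1\<close>. The bound is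
  stated through \<open>H - T\<close> because complements for different ends will be
  compared.\<close>

lemma card_irreducible_joins_le:
  assumes "finite H" "sym E" "irreducible_join E H T0 w"
  obtains T where "irreducible_join E H T w"
    "card {T. irreducible_join E H T w} \<le> card (H - T)"
proof -
  let ?Q = "{T. irreducible_join E H T w}"
  have fin: "finite ?Q"
    by (rule finite_subset[of _ "Pow H"]) (use assms(1) in \<open>auto dest: irreducible_joinD(3)\<close>)
  have "Min (card ` ?Q) \<in> card ` ?Q" using fin assms(3) by (intro Min_in) auto
  then obtain T where T: "irreducible_join E H T w" and m: "Min (card ` ?Q) = card T" by auto
  note D = irreducible_joinD[OF T]
  have finT: "finite T" using D assms(1) finite_subset by blast
  have inj: "inj_on card ?Q"
    using irreducible_join_nested[OF assms(1,2)] by (intro inj_onI) (simp add: subset_antisym)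
  have "card ` ?Q \<subseteq> {card T..<card H}"
  proof
    fix k assume "k \<in> card ` ?Q"
    then obtain T' where T': "irreducible_join E H T' w" and k: "k = card T'" by auto
    have "card T \<le> card T'" using T' fin m Min_le[of "card ` ?Q" "card T'"] by auto
    moreover have "card T' < card H"
      using irreducible_joinD[OF T'] assms(1) by (intro psubset_card_mono) auto
    ultimately show "k \<in> {card T..<card H}" using k by simp
  qed
  then have "card (card ` ?Q) \<le> card {card T..<card H}" by (intro card_mono) auto
  then have "card ?Q \<le> card H - card T" using card_image[OF inj] by simp
  also have "\<dots> = card (H - T)" using D(3) finT by (simp add: card_Diff_subset)
  finally show ?thesis using that T by blast
qed

definition irreducible_joins :: "('a \<times> 'a) set \<Rightarrow> 'a set \<Rightarrow> ('a set \<times> 'a) set" where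
  "irreducible_joins E H = {(T, w). irreducible_join E H T w}"

lemma finite_irreducible_joins:
  assumes "finite H"
  shows "finite (irreducible_joins E H)"
  by (rule finite_subset[of _ "Pow H \<times> H"])
    (use assms in \<open>auto simp: irreducible_joins_def dest: irreducible_joinD(3,4)\<close>)

text \<open>Either sets belonging to different ends always cover \<open>H\<close>, so that their
  complements are disjoint and the counts add up to at most \<open>card H\<close>, or some two sets
  fail to cover \<open>H\<close> and their ends are the only ones.\<close>

lemma card_irreducible_joins:
  assumes "finite H" "sym E"
  shows "card (irreducible_joins E H) \<le> card H \<or>
    (\<exists>w w'. w \<noteq> w' \<and> (\<exists>T. irreducible_join E H T w) \<and> (\<exists>T. irreducible_join E H T w') \<and>
      card (irreducible_joins E H) =
        card {T. irreducible_join E H T w} + card {T. irreducible_join E H T w'})"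
proof -
  let ?W = "{w. \<exists>T. irreducible_join E H T w}"
  let ?Q = "\<lambda>w. {T. irreducible_join E H T w}"
  have finW: "finite ?W"
    by (rule finite_subset[OF _ assms(1)]) (auto dest: irreducible_joinD(4))
  have finQ: "finite (?Q w)" for w
    by (rule finite_subset[of _ "Pow H"]) (use assms(1) in \<open>auto dest: irreducible_joinD(3)\<close>)
  have "irreducible_joins E H = (\<lambda>(w, T). (T, w)) ` (SIGMA w:?W. ?Q w)"
    unfolding irreducible_joins_def by auto
  then have "card (irreducible_joins E H) = card (SIGMA w:?W. ?Q w)"
    by (simp add: card_image inj_on_def)
  also have "\<dots> = (\<Sum>w\<in>?W. card (?Q w))"
    using finW finQ by (intro card_SigmaI) auto
  finally have sum: "card (irreducible_joins E H) = (\<Sum>w\<in>?W. card (?Q w))" .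
  show ?thesis
  proof (cases "\<forall>T w T' w'. irreducible_join E H T w \<longrightarrow> irreducible_join E H T' w' \<longrightarrow>
      w \<noteq> w' \<longrightarrow> T \<union> T' = H")
    case True
    have "\<forall>w\<in>?W. \<exists>T. irreducible_join E H T w \<and> card (?Q w) \<le> card (H - T)"
      using card_irreducible_joins_le[OF assms] by blast
    \<comment> \<open>\<open>F w\<close> is a set whose complement bounds the number of sets joined
      to \<open>w\<close>.\<close>
    then obtain F where F: "\<And>w. w \<in> ?W \<Longrightarrow> irreducible_join E H (F w) w"
      and le: "\<And>w. w \<in> ?W \<Longrightarrow> card (?Q w) \<le> card (H - F w)"
      by metis
    have "(\<Sum>w\<in>?W. card (?Q w)) \<le> (\<Sum>w\<in>?W. card (H - F w))"
      using le by (rule sum_mono)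
    also have "\<dots> = card (\<Union>w\<in>?W. H - F w)"
    proof (rule card_UN_disjoint[symmetric])
      show "\<forall>w\<in>?W. \<forall>w'\<in>?W. w \<noteq> w' \<longrightarrow> (H - F w) \<inter> (H - F w') = {}"
        using True F by blast
    qed (use finW assms(1) in auto)
    also have "\<dots> \<le> card H" using assms(1) by (intro card_mono) auto
    finally show ?thesis using sum by simp
  next
    case False
    then obtain T w T' w' where *: "irreducible_join E H T w" "irreducible_join E H T' w'"
      "w \<noteq> w'" "T \<union> T' \<noteq> H" by blast
    have "?W = {w, w'}"
      using irreducible_join_two_ends[OF assms *] * by blast
    with sum *(3) have "card (irreducible_joins E H) = card (?Q w) + card (?Q w')" by simp
    with * show ?thesis by blast
  qed
qed

text \<open>The set \<open>T\<close> from the chain bound is nonempty, so its complement misses at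
  least one vertex of \<open>H\<close>; it misses exactly one only if \<open>T\<close> is a
  singleton.\<close>

lemma card_irreducible_joins_less:
  assumes "finite H" "sym E" "irreducible_join E H T0 w"
  shows "card {T. irreducible_join E H T w} \<le> card H - 1"
    and "card {T. irreducible_join E H T w} = card H - 1 \<Longrightarrow> \<exists>u. irreducible_join E H {u} w"
proof -
  obtain T where T: "irreducible_join E H T w"
    and le: "card {T. irreducible_join E H T w} \<le> card (H - T)"
    using card_irreducible_joins_le[OF assms] by blast
  note D = irreducible_joinD[OF T]
  have fin: "finite T" using D assms(1) finite_subset by blast
  have c: "card (H - T) = card H - card T" "card T \<le> card H" "card T > 0" "card T < card H"
    using D fin assms(1) cut_connected_nonempty[OF D(2)]
    by (auto simp: card_Diff_subset card_mono card_gt_0_iff intro: psubset_card_mono)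
  show "card {T. irreducible_join E H T w} \<le> card H - 1" using le c by linarith
  assume "card {T. irreducible_join E H T w} = card H - 1"
  then have "card T = 1" using le c by linarith
  then show "\<exists>u. irreducible_join E H {u} w" using T card_1_singletonE by metis
qed

lemma card_irreducible_joins_bound:
  assumes "finite H" "sym E"
  shows "card (irreducible_joins E H) \<le> 2 * (card H - 1)"
proof (cases "irreducible_joins E H = {}")
  case False
  then obtain T w where T: "irreducible_join E H T w" by (auto simp: irreducible_joins_def)
  note D = irreducible_joinD[OF T]
  have "card T < card H" using D assms(1) by (intro psubset_card_mono) auto
  moreover have "card T > 0"
    using cut_connected_nonempty[OF D(2)] finite_subset[OF D(3) assms(1)] by (simp add: card_gt_0_iff)
  \<comment> \<open>This puts \<open>card H\<close>, the bound of the disjoint case, below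
    \<open>2 * (card H - 1)\<close>.\<close>
  ultimately have "card H \<ge> 2" by linarith
  show ?thesis
    using card_irreducible_joins[OF assms]
  proof (elim disjE exE conjE)
    assume "card (irreducible_joins E H) \<le> card H"
    with \<open>card H \<ge> 2\<close> show ?thesis by linarith
  next
    fix w w' T T'
    assume "irreducible_join E H T w" "irreducible_join E H T' w'"
      and "card (irreducible_joins E H) =
        card {T. irreducible_join E H T w} + card {T. irreducible_join E H T w'}"
    with card_irreducible_joins_less(1)[OF assms] show ?thesis
      by (metis add_mono mult_2)
  qed
qed simp

text \<open>The extremal case of the bound. The conclusion allows \<open>u = w\<close>, so that a
  one-vertex \<open>H\<close> is covered.\<close>

lemma irreducible_join_singleton_exists:
  assumes "finite H" "sym E" "cut_connected E H"
    and "card (irreducible_joins E H) = 2 * (card H - 1)"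
  obtains u w where "u \<in> H" "w \<in> H"
    "\<And>X. cut_connected E X \<Longrightarrow> X \<subseteq> H \<Longrightarrow> u \<in> X \<Longrightarrow> w \<in> X \<Longrightarrow> X = H"
proof (cases "card H \<le> 2")
  case True
  moreover have "card H \<noteq> 0" using cut_connected_nonempty[OF assms(3)] assms(1) by simp
  ultimately consider "card H = 1" | "card H = 2" by linarith
  then obtain u w where "H = {u, w}"
    by cases (metis card_1_singletonE insert_absorb2, metis card_2_iff)
  then show ?thesis using that[of u w] by blast
next
  case False
  \<comment> \<open>With three or more vertices \<open>2 * (card H - 1)\<close> exceeds
    \<open>card H\<close>, so exactly two ends occur and each attains its maximum
    \<open>card H - 1\<close>.\<close>
  then have "\<not> card (irreducible_joins E H) \<le> card H" using assms(4) by linarith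
  then obtain w w' where ex: "\<exists>T. irreducible_join E H T w" "\<exists>T. irreducible_join E H T w'"
    and "card (irreducible_joins E H) =
      card {T. irreducible_join E H T w} + card {T. irreducible_join E H T w'}"
    using card_irreducible_joins[OF assms(1,2)] by blast
  moreover have "card {T. irreducible_join E H T w} \<le> card H - 1"
    "card {T. irreducible_join E H T w'} \<le> card H - 1"
    using card_irreducible_joins_less(1)[OF assms(1,2)] ex by blast+
  ultimately have "card {T. irreducible_join E H T w} = card H - 1" using assms(4) by linarith
  then obtain u where "irreducible_join E H {u} w"
    using card_irreducible_joins_less(2)[OF assms(1,2)] ex(1) by blast
  note D = irreducible_joinD[OF this]
  show ?thesis using that[of u w] D(3,4,6) by blast
qed

text \<open>Double counting of the pairs of a connected set and an outside vertex. A pair may have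
  several minimal sets \<open>H\<close>, hence only an inequality.\<close>

lemma sum_card_Diff_le_card_irreducible_joins:
  assumes "finite V" "sym E" "cut_connected E V"
  defines "C \<equiv> {S. S \<subseteq> V \<and> cut_connected E S}"
  shows "(\<Sum>T\<in>C. card (V - T)) \<le> (\<Sum>H\<in>C. card (irreducible_joins E H))"
proof -
  have fin: "finite C" using assms(1) by (simp add: C_def)
  have finH: "finite H" if "H \<in> C" for H
    using that assms(1) finite_subset by (auto simp: C_def)
  have "(\<Sum>T\<in>C. card (V - T)) = card (SIGMA T:C. V - T)"
    using fin assms(1) by simp
  also have "\<dots> \<le> card (\<Union>H\<in>C. irreducible_joins E H)"
  proof (rule card_mono)
    show "finite (\<Union>H\<in>C. irreducible_joins E H)"
      using fin finH finite_irreducible_joins by blast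
    show "(SIGMA T:C. V - T) \<subseteq> (\<Union>H\<in>C. irreducible_joins E H)"
    proof clarify
      fix T w assume T: "T \<in> C" "w \<in> V" "w \<notin> T"
      then obtain H where "H \<subseteq> V" "irreducible_join E H T w"
        using irreducible_join_exists[OF assms(1,3), of T w] by (auto simp: C_def)
      then show "(T, w) \<in> (\<Union>H\<in>C. irreducible_joins E H)"
        using irreducible_joinD(1)[of E H T w] by (auto simp: C_def irreducible_joins_def)
    qed
  qed
  also have "\<dots> \<le> (\<Sum>H\<in>C. card (irreducible_joins E H))"
    using fin by (rule card_UN_le)
  finally show ?thesis .
qed

subsection \<open>Connected sets of symmetric digraphs\<close>

text \<open>The vertices reachable from \<open>u\<close> form a cut that no edge leaves; conversely
  a walk from inside a cut to outside has to cross it. \<open>R\<close> and \<open>E\<close> are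
  compared on \<open>S\<close> only, so that arcs of an induced subgraph can be matched with arcs of
  the whole graph.\<close>

lemma cut_connected_iff_rtrancl_on:
  assumes R: "\<And>a b. a \<in> S \<Longrightarrow> b \<in> S \<Longrightarrow> (a, b) \<in> R \<longleftrightarrow> (a, b) \<in> E"
  shows "cut_connected E S \<longleftrightarrow> S \<noteq> {} \<and> (\<forall>u\<in>S. \<forall>v\<in>S. (u, v) \<in> rtrancl_on S R)"
proof
  assume conn: "cut_connected E S"
  have "(u, v) \<in> rtrancl_on S R" if u: "u \<in> S" and v: "v \<in> S" for u v
  proof (rule ccontr)
    assume not: "(u, v) \<notin> rtrancl_on S R"
    let ?A = "{x \<in> S. (u, x) \<in> rtrancl_on S R}"
    have "u \<in> ?A" using u by auto
    moreover have "v \<notin> ?A" using not by simp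
    ultimately obtain a b where ab: "a \<in> ?A" "b \<in> S" "b \<notin> ?A" "(a, b) \<in> E"
      using cut_connectedE[OF conn, of ?A] v by blast
    then have "(a, b) \<in> R" using R by blast
    then have "(u, b) \<in> rtrancl_on S R"
      using ab by (auto intro: rtrancl_on_into_rtrancl_on)
    then show False using ab by blast
  qed
  then show "S \<noteq> {} \<and> (\<forall>u\<in>S. \<forall>v\<in>S. (u, v) \<in> rtrancl_on S R)"
    using cut_connected_nonempty[OF conn] by blast
next
  assume reach: "S \<noteq> {} \<and> (\<forall>u\<in>S. \<forall>v\<in>S. (u, v) \<in> rtrancl_on S R)"
  show "cut_connected E S"
    unfolding cut_connected_def
  proof (intro conjI allI impI)
    fix A assume A: "A \<noteq> {} \<and> A \<subset> S"
    then obtain u v where uv: "u \<in> A" "u \<in> S" "v \<in> S" "v \<notin> A" by blast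
    show "\<exists>a\<in>A. \<exists>b\<in>S - A. (a, b) \<in> E"
    proof (rule ccontr)
      assume none: "\<not> ?thesis"
      have "(u, v) \<in> rtrancl_on S R" using reach uv by blast
      then have "v \<in> A"
        by (induction rule: rtrancl_on_induct) (use uv A none R in blast)+
      with uv show False by blast
    qed
  qed (use reach in blast)
qed

lemma connected_induce_subgraph_iff:
  assumes "symmetric G" "S \<subseteq> verts G"
  shows "Digraph_Component.connected (G \<restriction> S) \<longleftrightarrow> cut_connected (arcs_ends G) S"
proof -
  have "(a, b) \<in> (arcs_ends (G \<restriction> S))\<^sup>s \<longleftrightarrow> (a, b) \<in> arcs_ends G" if "a \<in> S" "b \<in> S" for a b
    using that arcs_ends_symmetric[OF assms(1)]
    by (fastforce simp: symcl_def arcs_ends_conv)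
  from cut_connected_iff_rtrancl_on[OF this] show ?thesis
    by (simp add: connected_conv)
qed

lemma connected_iff_cut_connected:
  assumes "symmetric G"
  shows "Digraph_Component.connected G \<longleftrightarrow> cut_connected (arcs_ends G) (verts G)"
proof -
  have "(a, b) \<in> (arcs_ends G)\<^sup>s \<longleftrightarrow> (a, b) \<in> arcs_ends G" for a b
    using arcs_ends_symmetric[OF assms] by (auto simp: symcl_def)
  then show ?thesis
    by (subst cut_connected_iff_rtrancl_on[where R = "(arcs_ends G)\<^sup>s"]) (auto simp: connected_conv)
qed

lemma connected_sets_conv:
  assumes "symmetric G"
  shows "connected_sets G = {S. S \<subseteq> verts G \<and> cut_connected (arcs_ends G) S}"
  using connected_induce_subgraph_iff[OF assms] cut_connected_nonempty
  by (auto simp: connected_sets_def)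

subsection \<open>Path graphs\<close>

text \<open>Turns adjacency along a walk into arithmetic on positions.\<close>

lemma set_vwalk_arcs_conv_nth:
  "set (vwalk_arcs p) = {(p ! i, p ! Suc i) | i. Suc i < length p}"
proof (induction p rule: vwalk_arcs.induct)
  case (3 x y xs)
  have "{h i | i. Suc i < Suc n} = insert (h 0) {h (Suc i) | i. Suc i < n}"
    if "n > 0" for n and h :: "nat \<Rightarrow> 'a \<times> 'a"
  proof (intro equalityI subsetI)
    fix e assume "e \<in> {h i | i. Suc i < Suc n}"
    then obtain i where "i < n" "e = h i" by auto
    then show "e \<in> insert (h 0) {h (Suc i) | i. Suc i < n}" by (cases i) auto
  qed (use that in auto)
  from this[of "length (y # xs)" "\<lambda>i. ((x # y # xs) ! i, (x # y # xs) ! Suc i)"] 3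
  show ?case by simp
qed auto

lemma cut_connected_vwalk:
  assumes "vwalk p G" "symmetric G"
  shows "cut_connected (arcs_ends G) (set p)"
  using assms(1)
proof (induction p rule: vwalk_induct)
  case (Base u)
  then show ?case by (simp add: cut_connected_singleton)
next
  case (Cons u v es)
  have "cut_connected (arcs_ends G) (insert u (set (v # es)))"
    using Cons assms(2) by (intro cut_connected_insert[of _ _ v])
      (auto simp: symmetric_def dest: symD)
  then show ?case by simp
qed

text \<open>The vertices of a path from \<open>u\<close> to \<open>w\<close> form a connected set
  containing both ends, so the path visits every vertex. It remains to exclude edges between
  positions that are not consecutive.\<close>

lemma is_path_graphI:
  assumes "graph G" "cut_connected (arcs_ends G) (verts G)" "u \<in> verts G" "w \<in> verts G"
    and all: "\<And>X. cut_connected (arcs_ends G) X \<Longrightarrow> X \<subseteq> verts G \<Longrightarrow> u \<in> X \<Longrightarrow> w \<in> X \<Longrightarrow> X = verts G"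
  shows "is_path_graph G"
proof -
  interpret graph G by fact
  have sym: "symmetric G" by (rule sym_arcs)
  have "strongly_connected G"
    using symmetric_connected_imp_strongly_connected[OF sym] connected_iff_cut_connected[OF sym] assms(2)
    by blast
  then have "u \<rightarrow>\<^sup>*\<^bsub>G\<^esub> w" using assms by (auto simp: strongly_connected_def)
  then obtain p where p: "vpath p G" "hd p = u" "last p = w"
    using reachable_vpath_conv by blast
  then have walk: "vwalk p G" and dist: "distinct p" by (auto simp: vpath_def)
  then have ne: "p \<noteq> []" and arcs: "set (vwalk_arcs p) \<subseteq> arcs_ends G" and sub: "set p \<subseteq> verts G"
    by auto
  have set_p: "set p = verts G"
    using all[of "set p"] cut_connected_vwalk[OF walk sym] sub p(2,3) ne by auto
  \<comment> \<open>A chord of the path from u to w would bypass a vertex.\<close>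
  have consec: "j = Suc i" if ij: "i < j" "j < length p" and e: "(p ! i, p ! j) \<in> arcs_ends G" for i j
  proof (rule ccontr)
    assume "j \<noteq> Suc i"
    with ij have j: "Suc i < j" by simp
    \<comment> \<open>\<open>?a @ ?b\<close> is the shortcut through the chord. It still runs from
      \<open>u\<close> to \<open>w\<close> but skips \<open>p ! Suc i\<close>.\<close>
    let ?a = "take (Suc i) p" and ?b = "drop j p"
    have nea: "?a \<noteq> []" "?b \<noteq> []" using ij by auto
    have la: "last ?a = p ! i" and hb: "hd ?b = p ! j"
      using ij by (auto simp: take_Suc_conv_app_nth hd_drop_conv_nth)
    have "vwalk ?a G" "vwalk ?b G"
      using vwalkI_append_l[of ?a "drop (Suc i) p"] vwalkI_append_r[of ?b "take j p"] walk nea by auto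
    then have "vwalk (?a @ ?b) G"
      using vwalk_arcs_append[OF nea] la hb e nea by (auto simp: vwalk_def)
    then have conn: "cut_connected (arcs_ends G) (set (?a @ ?b))"
      using cut_connected_vwalk sym by blast
    have "u \<in> set (?a @ ?b)" using p(2) ne by (cases p) auto
    moreover have "w \<in> set (?a @ ?b)"
      using p(3) ij last_in_set[OF nea(2)] by (auto simp: last_drop)
    moreover have "set (?a @ ?b) \<subseteq> verts G"
      using sub set_take_subset[of "Suc i" p] set_drop_subset[of j p] by auto
    ultimately have "p ! Suc i \<in> set (?a @ ?b)"
      using all[OF conn] set_p j ij nth_mem[of "Suc i" p] by (metis order.strict_trans)
    then obtain k where "k < length p" "p ! k = p ! Suc i" "k < Suc i \<or> j \<le> k"
      by (auto simp: in_set_conv_nth) (metis le_add1 less_diff_conv add.commute)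
    then show False using dist j ij nth_eq_iff_index_eq[OF dist, of k "Suc i"] by auto
  qed
  have "arcs_ends G = set (vwalk_arcs p) \<union> (set (vwalk_arcs p))\<inverse>"
  proof (intro equalityI subsetI)
    fix e assume e: "e \<in> arcs_ends G"
    obtain a b where ab: "e = (a, b)" by fastforce
    have "a \<in> verts G" "b \<in> verts G" using e ab adj_in_verts by auto
    then obtain i j where i: "i < length p" "a = p ! i" and j: "j < length p" "b = p ! j"
      using set_p by (metis in_set_conv_nth)
    have "i \<noteq> j" using adj_not_same e ab i j by blast
    then consider "i < j" | "j < i" by linarith
    then show "e \<in> set (vwalk_arcs p) \<union> (set (vwalk_arcs p))\<inverse>"
    proof cases
      case 1
      then have "j = Suc i" using consec e ab i j by blast
      then show ?thesis using ab i j by (auto simp: set_vwalk_arcs_conv_nth)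
    next
      case 2
      then have "i = Suc j" using consec[of j i] graph_symmetric e ab i j by blast
      then show ?thesis using ab i j by (auto simp: set_vwalk_arcs_conv_nth)
    qed
  next
    fix e assume "e \<in> set (vwalk_arcs p) \<union> (set (vwalk_arcs p))\<inverse>"
    then show "e \<in> arcs_ends G" using arcs graph_symmetric by blast
  qed
  then show ?thesis using p(1) set_p by (auto simp: is_path_graph_def)
qed

section \<open>Connected sets of a path and their average size\<close>

text \<open>Edges change the position by one, so a connected set cannot skip a position between its
  first and its last. Conversely an interval is built up one vertex at a time.\<close>

lemma cut_connected_path_iff:
  assumes "distinct p" and E: "E = set (vwalk_arcs p) \<union> (set (vwalk_arcs p))\<inverse>"
  shows "S \<subseteq> set p \<and> cut_connected E S \<longleftrightarrow>
    (\<exists>i j. i \<le> j \<and> j < length p \<and> S = (!) p ` {i..j})"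
proof (intro iffI; (elim exE conjE)?)
  assume sub: "S \<subseteq> set p" and conn: "cut_connected E S"
  let ?I = "{i. i < length p \<and> p ! i \<in> S}"
  have S: "S = (!) p ` ?I" using sub by (force simp: in_set_conv_nth subset_iff)
  have ne: "?I \<noteq> {}" using S cut_connected_nonempty[OF conn] by blast
  have fin: "finite ?I" by simp
  define i j where "i = Min ?I" and "j = Max ?I"
  have i: "i \<in> ?I" and j: "j \<in> ?I" and ij: "i \<le> j"
    using Min_in[OF fin ne] Max_in[OF fin ne] Min_le[OF fin] by (auto simp: i_def j_def)
  have "k \<in> ?I" if k: "i \<le> k" "k \<le> j" for k
  proof (rule ccontr)
    assume nk: "k \<notin> ?I"
    \<comment> \<open>The part of \<open>S\<close> before the gap \<open>k\<close>; an edge leaving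
      it inside \<open>S\<close> would have to jump over \<open>k\<close>.\<close>
    let ?A = "(!) p ` {l \<in> ?I. l < k}"
    have "i < k" "k < j" using k i j nk by (auto simp: order.order_iff_strict)
    have "p ! i \<in> ?A" using i \<open>i < k\<close> by blast
    moreover have "p ! j \<notin> ?A"
      using j \<open>k < j\<close> nth_eq_iff_index_eq[OF assms(1)] by force
    ultimately obtain a b where ab: "a \<in> ?A" "b \<in> S" "b \<notin> ?A" "(a, b) \<in> E"
      using cut_connectedE[OF conn, of ?A] j by blast
    from ab(1) obtain l where l: "l \<in> ?I" "l < k" "a = p ! l" by blast
    from ab(2) S obtain m where m: "m \<in> ?I" "b = p ! m" by blast
    have mk: "k < m" 
    proof (rule ccontr)
      assume "\<not> k < m"
      then have "m < k" using m(1) nk by (cases "m = k") auto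
      then show False using ab(3) m by blast
    qed
    have "Suc l = m \<or> Suc m = l"
      using ab(4) l m unfolding E set_vwalk_arcs_conv_nth
      by (auto simp: nth_eq_iff_index_eq[OF assms(1)])
    then show False using l mk by linarith
  qed
  moreover have "i \<le> k \<and> k \<le> j" if "k \<in> ?I" for k
    using that fin by (simp add: i_def j_def)
  ultimately have "?I = {i..j}" by (intro equalityI subsetI) (simp_all only: atLeastAtMost_iff)
  then show "\<exists>i j. i \<le> j \<and> j < length p \<and> S = (!) p ` {i..j}"
    using S ij j by auto
next
  fix i j assume ij: "i \<le> j" "j < length p" and S: "S = (!) p ` {i..j}"
  have "sym E" unfolding E by (auto simp: sym_def)
  have "cut_connected E ((!) p ` {i..j})"
    using ij
  proof (induction rule: dec_induct)
    case base
    then show ?case by (simp add: cut_connected_singleton)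
  next
    case (step m)
    have "(p ! m, p ! Suc m) \<in> E"
      using step unfolding E set_vwalk_arcs_conv_nth by auto
    then have "cut_connected E (insert (p ! Suc m) ((!) p ` {i..m}))"
      using step \<open>sym E\<close> by (intro cut_connected_insert[of _ _ "p ! m"]) auto
    moreover have "{i..Suc m} = insert (Suc m) {i..m}" using step by auto
    ultimately show ?case by simp
  qed
  then show "S \<subseteq> set p \<and> cut_connected E S" using S ij by auto
qed

text \<open>The intervals ending at \<open>j\<close> have lengths 1 to \<open>Suc j\<close>, which
  sum to a triangular number; doubling avoids division on naturals.\<close>

lemma sum_lengths_below: "2 * (\<Sum>i\<le>j. Suc j - i) = Suc j * Suc (Suc j)"
proof -
  have "(\<Sum>i\<le>j. Suc j - i) = (\<Sum>i\<le>j. Suc i)"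
    by (rule sum.reindex_bij_witness[of _ "\<lambda>i. j - i" "\<lambda>i. j - i"]) auto
  moreover have "2 * (\<Sum>i\<le>j. Suc i) = Suc j * Suc (Suc j)"
    by (induction j) auto
  ultimately show ?thesis by simp
qed

text \<open>There are n(n+1)/2 intervals, of total size n(n+1)(n+2)/6, and the quotient is
  (n+2)/3.\<close>

lemma avg_connected_path:
  assumes "symmetric G" "is_path_graph G"
  shows "avg_connected G = (real (card (verts G)) + 2) / 3"
proof -
  from assms(2) obtain p where p: "vpath p G" "set p = verts G"
    and E: "arcs_ends G = set (vwalk_arcs p) \<union> (set (vwalk_arcs p))\<inverse>"
    by (auto simp: is_path_graph_def)
  have dist: "distinct p" and ne: "p \<noteq> []" using p(1) by (auto simp: vpath_def vwalk_def)
  define n where "n = length p"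
  have n: "card (verts G) = n" "n > 0"
    using p(2) distinct_card[OF dist] ne by (auto simp: n_def)
  \<comment> \<open>The right end \<open>j\<close> comes first, so that the inner sum runs over the
    intervals ending at \<open>j\<close>.\<close>
  let ?f = "\<lambda>(j, i). (!) p ` {i..j}" and ?D = "SIGMA j:{..<n}. {..j}"
  have C: "connected_sets G = ?f ` ?D"
    unfolding connected_sets_conv[OF assms(1)]
    unfolding p(2)[symmetric] cut_connected_path_iff[OF dist E] by (force simp: n_def image_iff)
  have inj_nth: "inj_on ((!) p) {..<n}"
    using dist by (simp add: inj_on_nth n_def)
  have inj: "inj_on ?f ?D"
  proof (rule inj_onI, clarsimp)
    fix j i j' i'
    assume *: "j < n" "i \<le> j" "j' < n" "i' \<le> j'" "(!) p ` {i..j} = (!) p ` {i'..j'}"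
    moreover have "{i..j} \<subseteq> {..<n}" "{i'..j'} \<subseteq> {..<n}" using * by auto
    ultimately have "{i..j} = {i'..j'}"
      using inj_on_image_eq_iff[OF inj_nth, of "{i..j}" "{i'..j'}"] by blast
    \<comment> \<open>The intervals are nonempty, so they determine their endpoints.\<close>
    then show "j = j' \<and> i = i'" using * by (simp add: Icc_eq_Icc)
  qed
  have card: "card (?f x) = Suc (fst x) - snd x" if x: "x \<in> ?D" for x
  proof -
    obtain j i where ji: "x = (j, i)" by fastforce
    have "inj_on ((!) p) {i..j}" using x ji by (intro inj_on_subset[OF inj_nth]) auto
    then show ?thesis using ji by (simp add: card_image)
  qed
  have "card (connected_sets G) = (\<Sum>j<n. Suc j)"
    unfolding C card_image[OF inj] by simp
  also have "2 * \<dots> = n * Suc n" by (induction n) auto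
  finally have N: "2 * card (connected_sets G) = n * Suc n" by simp
  have "(\<Sum>S\<in>connected_sets G. card S) = (\<Sum>x\<in>?D. Suc (fst x) - snd x)"
    unfolding C using card by (simp add: sum.reindex[OF inj])
  also have "\<dots> = (\<Sum>j<n. \<Sum>i\<le>j. Suc j - i)"
    by (subst sum.Sigma) (auto intro: sum.cong)
  finally have "2 * (\<Sum>S\<in>connected_sets G. card S) = (\<Sum>j<n. Suc j * Suc (Suc j))"
    by (simp only: sum_distrib_left[of 2 _ "{..<n}"] sum_lengths_below)
  moreover have "3 * (\<Sum>j<n. Suc j * Suc (Suc j)) = n * Suc n * (n + 2)"
    by (induction n) (auto simp: algebra_simps)
  ultimately have "6 * (\<Sum>S\<in>connected_sets G. card S) = n * Suc n * (n + 2)" by simp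
  then have "3 * (\<Sum>S\<in>connected_sets G. card S) = card (connected_sets G) * (n + 2)"
    unfolding N[symmetric] by simp
  then have "3 * (\<Sum>S\<in>connected_sets G. real (card S)) = real (card (connected_sets G)) * (real n + 2)"
    by (metis of_nat_add of_nat_mult of_nat_numeral of_nat_sum)
  moreover have "card (connected_sets G) \<noteq> 0" using N n(2) by auto
  ultimately show ?thesis using n(1) by (simp add: avg_connected_def field_simps)
qed

subsection \<open>The average size\<close>

theorem theorem1:
  fixes G :: "('a, 'b) pre_digraph" and n :: nat
  assumes "graph G"
    and "Digraph_Component.connected G"
    and "card (verts G) = n"
  shows "avg_connected G \<ge> (real n + 2) / 3 \<and>
         (avg_connected G = (real n + 2) / 3 \<longleftrightarrow> is_path_graph G)"
proof -
  interpret graph G by fact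
  let ?E = "arcs_ends G" and ?V = "verts G" and ?C = "connected_sets G"
  let ?Q = "\<lambda>H. card (irreducible_joins ?E H)"
  have symG: "symmetric G" by (rule sym_arcs)
  then have sym: "sym ?E" by (simp add: symmetric_def)
  have C: "?C = {S. S \<subseteq> ?V \<and> cut_connected ?E S}" by (rule connected_sets_conv[OF symG])
  have finC: "finite ?C" by (simp add: C)
  have conn: "cut_connected ?E ?V" using assms(2) connected_iff_cut_connected[OF symG] by simp
  then have V: "?V \<in> ?C" by (simp add: C)
  have finH: "finite H" and neH: "H \<noteq> {}" and subH: "H \<subseteq> ?V" if "H \<in> ?C" for H
    using that finite_subset[OF _ finite_verts] cut_connected_nonempty by (auto simp: C)
  have pos: "card ?C > 0" using V finC by (auto simp: card_gt_0_iff)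
  let ?N = "real (card ?C)" and ?S = "\<Sum>H\<in>?C. real (card H)"
  have avg: "avg_connected G * ?N = ?S" using pos by (simp add: avg_connected_def)
  have "(\<Sum>T\<in>?C. card (?V - T)) \<le> (\<Sum>H\<in>?C. ?Q H)"
    using sum_card_Diff_le_card_irreducible_joins[OF finite_verts sym conn] by (simp add: C)
  then have "real (\<Sum>T\<in>?C. card (?V - T)) \<le> real (\<Sum>H\<in>?C. ?Q H)"
    by (simp only: of_nat_le_iff)
  moreover have "real (card (?V - T)) = real n - real (card T)" if "T \<in> ?C" for T
    using card_Diff_subset[OF finH[OF that] subH[OF that]]
      card_mono[OF finite_verts subH[OF that]] assms(3) by simp
  ultimately have lower: "real n * ?N - ?S \<le> real (\<Sum>H\<in>?C. ?Q H)"
    by (simp add: sum_subtractf mult.commute)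
  have bound: "?Q H \<le> 2 * (card H - 1)" if "H \<in> ?C" for H
    using card_irreducible_joins_bound[OF finH[OF that] sym] .
  \<comment> \<open>Connected sets are nonempty, so the subtraction on naturals is not
    truncated.\<close>
  have "real (2 * (card H - 1)) = 2 * real (card H) - 2" if "H \<in> ?C" for H
    using finH[OF that] neH[OF that] by (simp add: of_nat_diff card_gt_0_iff Suc_le_eq)
  then have upper: "real (\<Sum>H\<in>?C. 2 * (card H - 1)) = 2 * ?S - 2 * ?N"
    by (simp add: sum_subtractf sum_distrib_left)
  have "real (\<Sum>H\<in>?C. ?Q H) \<le> real (\<Sum>H\<in>?C. 2 * (card H - 1))"
    unfolding of_nat_le_iff using bound by (rule sum_mono)
  \<comment> \<open>With N connected sets of total size S, the estimates give nN - S \<le> 2S -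
    2N.\<close>
  then have "(real n + 2) * ?N \<le> 3 * ?S"
    unfolding distrib_right using lower upper by linarith
  then have "(real n + 2) * ?N \<le> 3 * avg_connected G * ?N" using avg by simp
  then have ge: "avg_connected G \<ge> (real n + 2) / 3" using pos by simp
  have "is_path_graph G" if eq: "avg_connected G = (real n + 2) / 3"
  proof -
    have "(real n + 2) * ?N = 3 * ?S" unfolding avg[symmetric] eq by simp
    then have "real (\<Sum>H\<in>?C. 2 * (card H - 1)) \<le> real (\<Sum>H\<in>?C. ?Q H)"
      unfolding distrib_right using lower upper by linarith
    then have "\<not> (\<Sum>H\<in>?C. ?Q H) < (\<Sum>H\<in>?C. 2 * (card H - 1))" by linarith
    \<comment> \<open>Equal sums with a termwise bound force equality in every term, in particular
      in the one for \<open>?V\<close>.\<close>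
    then have "\<not> ?Q ?V < 2 * (card ?V - 1)"
      using sum_strict_mono_ex1[OF finC, of ?Q "\<lambda>H. 2 * (card H - 1)"] bound V by blast
    then have "?Q ?V = 2 * (card ?V - 1)" using bound[OF V] by linarith
    then obtain u w where "u \<in> ?V" "w \<in> ?V"
      "\<And>X. cut_connected ?E X \<Longrightarrow> X \<subseteq> ?V \<Longrightarrow> u \<in> X \<Longrightarrow> w \<in> X \<Longrightarrow> X = ?V"
      using irreducible_join_singleton_exists[OF finite_verts sym conn] by blast
    then show ?thesis using is_path_graphI[OF assms(1) conn] by blast
  qed
  then show ?thesis using ge avg_connected_path[OF symG] assms(3) by blast
qed

end
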